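(* For $\rho=\log_{10}2$, two adjacent (regular continued-fraction) convergents are $$\frac{1\,936\,274}{6\,432\,163},\qquad\frac{13\,456\,039}{44\,699\,994},$$ and $$d=\|6\,432\,163\log_{10}2\|=2.0276549588410307779\ldots\times10^{-8}.$$ The least integer $M$ satisfying the safe threshold $M\ge\frac{44\,699\,994}{10^{d/2}-1}-1$ is $$M_{\rm safe}=1\,914\,818\,931\,502\,442.$$ Thus, for every integer $M\ge M_{\rm safe}$ and every integer $1\le H\le44\,699\,994$, the entire block $(M,M+H]$ is reduced by the safe locator to at most one candidate for exact verification of membership in $\mathcal S_{2,10}$.
   Context: $\mathcal S_{2,10}$ is the set of integers $m\ge1$ for which there is an integer $k\ge0$ with $m10^k\le 2^m<(m+1)10^k$. $\|x\|$ is the distance to the nearest integer, $\{x\}=x-\lfloor x\rfloor$, $\mathbb T=\mathbb R/\mathbb Z$. Safe locator for the block $(M,M+H]$ with the adjacent denominators $q_-=6\,432\,163$, $q_+=44\,699\,994$: put $\theta=\{M\rho-\log_{10}(M+1)\}$ and $t_H=\log_{10}\frac{M+H+1}{M+1}$, choose an integer $Q>16(H+3)(q_++q_-)$, let $B,P$ be nearest integers to $Q\theta,Q\rho$, and let $\mathcal J_Q\subset\mathbb T$ be the arc $[-\frac{H+1}Q,t_H+\frac{H+1}Q]\bmod1$ with each endpoint rounded outward to the $Q^{-1}$ grid by less than $3/Q$. The locator reports the candidates $M+i$, $1\le i\le H$, with $\frac{(B+Pi)\bmod Q}{Q}\in\mathcal J_Q$. "Reduced to at most one candidate" means that the reported set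 contains every element of $\mathcal S_{2,10}\cap(M,M+H]$ and has at most one element. *)

theory Defs
  imports Complex_Main
begin

definition rho :: real where
  "rho = log 10 2"

definition S_2_10 :: "int set" where
  "S_2_10 = {m. m \<ge> 1 \<and> (\<exists>k::nat. m * 10 ^ k \<le> 2 ^ nat m \<and> 2 ^ nat m < (m + 1) * 10 ^ k)}"

definition dist_int :: "real \<Rightarrow> real" where
  "dist_int x = \<bar>x - of_int (round x)\<bar>"

definition nearest_int :: "int \<Rightarrow> real \<Rightarrow> bool" where
  "nearest_int B x \<longleftrightarrow> (\<forall>n::int. \<bar>x - of_int B\<bar> \<le> \<bar>x - of_int n\<bar>)"

text \<open>
  Regular continued fraction of \<open>x\<close>: complete quotients, partial quotients, and numerators and
  denominators of the convergents, given by the usual recurrences. For rational \<open>x\<close> the expansion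
  terminates, and the values after the last partial quotient are junk (\<open>1 / 0 = 0\<close>); only the
  irrational \<open>rho\<close> is used below.
\<close>

fun cf_complete :: "real \<Rightarrow> nat \<Rightarrow> real" where
  "cf_complete x 0 = x"
| "cf_complete x (Suc n) = 1 / frac (cf_complete x n)"

definition cf_quot :: "real \<Rightarrow> nat \<Rightarrow> int" where
  "cf_quot x n = \<lfloor>cf_complete x n\<rfloor>"

fun cf_num :: "real \<Rightarrow> nat \<Rightarrow> int" where
  "cf_num x 0 = cf_quot x 0"
| "cf_num x (Suc 0) = cf_quot x 1 * cf_quot x 0 + 1"
| "cf_num x (Suc (Suc n)) = cf_quot x (Suc (Suc n)) * cf_num x (Suc n) + cf_num x n"

fun cf_den :: "real \<Rightarrow> nat \<Rightarrow> int" where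
  "cf_den x 0 = 1"
| "cf_den x (Suc 0) = cf_quot x 1"
| "cf_den x (Suc (Suc n)) = cf_quot x (Suc (Suc n)) * cf_den x (Suc n) + cf_den x n"

definition adjacent_convergents :: "real \<Rightarrow> int \<Rightarrow> int \<Rightarrow> int \<Rightarrow> int \<Rightarrow> bool" where
  "adjacent_convergents x p q p' q' \<longleftrightarrow>
     (\<exists>n. cf_num x n = p \<and> cf_den x n = q \<and> cf_num x (Suc n) = p' \<and> cf_den x (Suc n) = q')"

definition safe_threshold :: "int \<Rightarrow> real \<Rightarrow> int \<Rightarrow> bool" where
  "safe_threshold qp d M \<longleftrightarrow> real_of_int M \<ge> real_of_int qp / (10 powr (d / 2) - 1) - 1"

definition loc_theta :: "int \<Rightarrow> real" where
  "loc_theta M = frac (real_of_int M * rho - log 10 (real_of_int M + 1))"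

definition loc_t :: "int \<Rightarrow> int \<Rightarrow> real" where
  "loc_t M H = log 10 ((real_of_int M + real_of_int H + 1) / (real_of_int M + 1))"

text \<open>
  The circle is represented by \<open>[0, 1)\<close> via \<open>frac\<close>. The rounded arc has endpoints \<open>u / Q\<close> and
  \<open>v / Q\<close>; which outward grid points within \<open>3 / Q\<close> are chosen is left open, as is the
  choice between two equally near integers for \<open>B\<close> and \<open>P\<close>.
\<close>

definition rounded_outward :: "int \<Rightarrow> real \<Rightarrow> real \<Rightarrow> int \<Rightarrow> int \<Rightarrow> bool" where
  "rounded_outward Q a b u v \<longleftrightarrow>
     of_int u / of_int Q \<le> a \<and> a - of_int u / of_int Q < 3 / of_int Q \<and>
     b \<le> of_int v / of_int Q \<and> of_int v / of_int Q - b < 3 / of_int Q"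

definition circle_arc :: "int \<Rightarrow> int \<Rightarrow> int \<Rightarrow> real set" where
  "circle_arc Q u v = frac ` {of_int u / of_int Q .. of_int v / of_int Q}"

definition safe_locator_data ::
    "int \<Rightarrow> int \<Rightarrow> int \<Rightarrow> int \<Rightarrow> int \<Rightarrow> int \<Rightarrow> int \<Rightarrow> int \<Rightarrow> int \<Rightarrow> bool" where
  "safe_locator_data qm qp M H Q B P u v \<longleftrightarrow>
     Q > 16 * (H + 3) * (qp + qm) \<and>
     nearest_int B (of_int Q * loc_theta M) \<and>
     nearest_int P (of_int Q * rho) \<and>
     rounded_outward Q
       (- (of_int (H + 1) / of_int Q)) (loc_t M H + of_int (H + 1) / of_int Q) u v"

definition reported :: "int \<Rightarrow> int \<Rightarrow> int \<Rightarrow> int \<Rightarrow> int \<Rightarrow> int \<Rightarrow> int \<Rightarrow> int set" where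
  "reported M H Q B P u v =
     {M + i | i. 1 \<le> i \<and> i \<le> H \<and> real_of_int ((B + P * i) mod Q) / of_int Q \<in> circle_arc Q u v}"

definition reduced_to_at_most_one :: "int \<Rightarrow> int \<Rightarrow> int set \<Rightarrow> bool" where
  "reduced_to_at_most_one M H R \<longleftrightarrow>
     S_2_10 \<inter> {M<..M + H} \<subseteq> R \<and> finite R \<and> card R \<le> 1"

end

theory Submission
  imports Defs "HOL-Analysis.Harmonic_Numbers"
begin

text \<open>
  Multiplying the membership condition of \<open>m = M + i\<close> out and taking logarithms puts the point
  \<open>\<theta> + i \<rho>\<close>, reduced mod 1, into the arc \<open>[0, t\<^sub>H]\<close>. Replacing \<open>\<theta>\<close> and \<open>\<rho>\<close> by grid points
  moves it by at most \<open>(i + 1) / (2 Q)\<close>, less than the margin built into the arc, so no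
  member is lost (\<open>locator_complete\<close>).

  Conversely, let \<open>M + i\<close> and \<open>M + j\<close> be reported, \<open>i < j\<close>. Both points lie in one short arc, so
  \<open>(j - i) \<rho>\<close> is within \<open>t\<^sub>H\<close> plus \<open>O(H / Q)\<close> of an integer. As \<open>0 < j - i < q\<^sub>+\<close>, the best
  approximation property of convergents keeps it at distance at least \<open>d = \<parallel>q\<^sub>- \<rho>\<parallel>\<close> from
  the integers (\<open>rho_multiples_far_from_integers\<close>). The threshold on \<open>M\<close> is exactly what makes
  \<open>t\<^sub>H \<le> d / 2\<close> for all \<open>H \<le> q\<^sub>+\<close>, and the lower bound on \<open>Q\<close> makes the grid error smaller than
  \<open>d / 2\<close>, because \<open>d (q\<^sub>+ + q\<^sub>-) \<ge> 1\<close>; this is a contradiction (\<open>locator_separates\<close>).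

  The numerical claims all come from one decimal enclosure of \<open>\<rho> = ln 2 / (3 ln 2 + ln (5/4))\<close>,
  obtained from the rapidly convergent series of \<open>ln\<close> in powers of \<open>(x - 1) / (x + 1)\<close>. Every
  complete quotient of \<open>\<rho>\<close> is a quotient of two integral linear forms in \<open>\<rho>\<close>, so each step of
  the continued fraction is a pair of linear inequalities in \<open>\<rho>\<close>; \<open>d\<close> is itself such a form.
  The threshold is a comparison of \<open>(d / 2) ln 10\<close> with \<open>ln (1 + q\<^sub>+ / N)\<close> for two consecutive
  integers \<open>N\<close>, where one term of the same series suffices.
\<close>

section \<open>Decimal enclosures of logarithms\<close>

lemma ln_interval:
  fixes x l u :: real and n :: nat
  defines "y \<equiv> (x - 1) / (x + 1)"
  assumes "x > 1"
    and "l \<le> (\<Sum>k<n. 2 * y ^ (2 * k + 1) / of_nat (2 * k + 1))"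
    and "(\<Sum>k<n. 2 * y ^ (2 * k + 1) / of_nat (2 * k + 1))
           + 2 * (y ^ (2 * n + 1) / (1 - y\<^sup>2) / of_nat (2 * n + 1)) \<le> u"
  shows "ln x \<in> {l..u}"
  using ln_approx_bounds[of x n] assms by (auto simp: y_def)

text \<open>
  With \<open>(x - 1) / (x + 1) = 1/3\<close>, the remainder after 43 terms is below \<open>3\<^sup>-\<^sup>8\<^sup>7\<close>, which resolves
  40 decimals; for \<open>x = 5/4\<close> the ratio is \<open>1/9\<close> and half as many terms do.
\<close>

lemma ln_2_bounds:
  "ln (2::real) \<in> {6931471805599453094172321214581765680755 / 10 ^ 40 ..
                   6931471805599453094172321214581765680756 / 10 ^ 40}"
  by (rule ln_interval[where n = 43]; simp add: lessThan_nat_numeral lessThan_Suc power_divide)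

lemma ln_5_4_bounds:
  "ln (5 / 4 :: real) \<in> {2231435513142097557662950903098345033746 / 10 ^ 40 ..
                        2231435513142097557662950903098345033747 / 10 ^ 40}"
  by (rule ln_interval[where n = 22]; simp add: lessThan_nat_numeral lessThan_Suc power_divide)

lemma ln_10_eq: "ln (10::real) = 3 * ln 2 + ln (5 / 4)"
proof -
  have "ln (10::real) = ln (2 ^ 3 * (5 / 4))" by simp
  also have "\<dots> = ln (2 ^ 3) + ln (5 / 4)" by (rule ln_mult_pos) simp_all
  also have "ln (2 ^ 3 :: real) = 3 * ln 2" by (subst ln_realpow) simp_all
  finally show ?thesis .
qed

lemma ln_10_bounds:
  "2302585092994045684017991454684364207600 / 10 ^ 39 \<le> ln (10::real)"
  "ln (10::real) \<le> 2302585092994045684017991454684364207602 / 10 ^ 39"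
  using ln_2_bounds ln_5_4_bounds by (simp_all add: ln_10_eq)

text \<open>
  The precision is dictated by \<open>d\<close>: it is known to within \<open>6432163\<close> times the error of \<open>\<rho>\<close>, and
  the claimed digits leave a margin of about \<open>2 \<cdot> 10\<^sup>-\<^sup>2\<^sup>8\<close>.
\<close>

lemma rho_bounds:
  "30102999566398119521373889472449302676 / 10 ^ 38 \<le> rho"
  "rho \<le> 30102999566398119521373889472449302677 / 10 ^ 38"
proof -
  have pos: "3 * ln 2 + ln (5 / 4) > (0::real)" by (simp add: add_pos_pos)
  have rho: "rho = ln 2 / (3 * ln 2 + ln (5 / 4))" by (simp add: rho_def log_def ln_10_eq)
  show "30102999566398119521373889472449302676 / 10 ^ 38 \<le> rho"
    unfolding rho pos_le_divide_eq[OF pos] using ln_2_bounds ln_5_4_bounds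
    by (simp add: field_simps)
  show "rho \<le> 30102999566398119521373889472449302677 / 10 ^ 38"
    unfolding rho pos_divide_le_eq[OF pos] using ln_2_bounds ln_5_4_bounds
    by (simp add: field_simps)
qed

section \<open>Continued fraction of \<open>\<rho>\<close>\<close>

text \<open>
  Two consecutive convergents determine the next complete quotient by the Moebius formula in
  the last conjunct. Carrying the formula along avoids iterated reciprocals: the complete
  quotient stays a ratio of the approximation errors of the two convergents.
\<close>

definition cf_state :: "real \<Rightarrow> nat \<Rightarrow> int \<Rightarrow> int \<Rightarrow> int \<Rightarrow> int \<Rightarrow> bool" where
  "cf_state x n p q p' q' \<longleftrightarrow>
     cf_num x n = p \<and> cf_den x n = q \<and> cf_num x (Suc n) = p' \<and> cf_den x (Suc n) = q' \<and>
     cf_complete x (Suc (Suc n)) = (of_int p - of_int q * x) / (of_int q' * x - of_int p')"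

text \<open>
  Let \<open>v\<close> be the error of the current convergent and \<open>w\<close> the error of the proposed next one. The
  complete quotient is \<open>a - w / v\<close>, so \<open>a\<close> is its integer part exactly if the errors alternate in
  sign and decrease: \<open>0 \<le> - w / v < 1\<close>. For numerical \<open>p\<close> and \<open>q\<close> this is linear in \<open>x\<close>.
\<close>

lemma cf_state_step:
  fixes x :: real
  assumes state: "cf_state x n p q p' q'"
    and rec: "m = Suc n" "p'' = a * p' + p" "q'' = a * q' + q"
    and sign: "(let v = of_int q' * x - of_int p'; w = of_int q'' * x - of_int p'' in
                  0 < v \<and> - v < w \<and> w \<le> 0 \<or> v < 0 \<and> 0 \<le> w \<and> w < - v)"
  shows "cf_state x m p' q' p'' q''"
proof -
  define v where "v = of_int q' * x - of_int p'"
  define w where "w = of_int q'' * x - of_int p''"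
  have vw: "0 < v \<and> - v < w \<and> w \<le> 0 \<or> v < 0 \<and> 0 \<le> w \<and> w < - v"
    using sign by (simp add: Let_def v_def w_def)
  have uw: "of_int p - of_int q * x = of_int a * v - w"
    by (simp add: v_def w_def rec algebra_simps)
  have "cf_complete x (Suc (Suc n)) = (of_int a * v - w) / v"
    using state by (simp add: cf_state_def uw flip: v_def)
  also have "\<dots> = of_int a + - w / v"
    using vw by (auto simp: field_simps)
  finally have compl: "cf_complete x (Suc (Suc n)) = of_int a + - w / v" .
  have bds: "0 \<le> - w / v" "- w / v < 1"
    using vw by (auto simp: divide_simps)
  have fl: "\<lfloor>cf_complete x (Suc (Suc n))\<rfloor> = a"
    unfolding compl using bds by linarith
  have "cf_complete x (Suc (Suc (Suc n))) = 1 / frac (cf_complete x (Suc (Suc n)))"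
    by (rule cf_complete.simps)
  also have "\<dots> = 1 / (- w / v)"
    by (simp only: frac_def fl) (simp add: compl del: cf_complete.simps)
  also have "\<dots> = (- v) / w" by simp
  also have "- v = of_int p' - of_int q' * x" by (simp add: v_def)
  finally show ?thesis
    using state fl by (simp add: cf_state_def cf_quot_def rec w_def del: cf_complete.simps)
qed

lemma rho_adjacent_convergents:
  "adjacent_convergents rho 1936274 6432163 13456039 44699994"
proof -
  have f0: "\<lfloor>rho\<rfloor> = 0" and f1: "\<lfloor>1 / rho\<rfloor> = 3"
    using rho_bounds by (simp_all add: floor_eq_iff field_simps)
  have s0: "cf_state rho 0 0 1 1 3"
    using f0 f1 rho_bounds
    by (simp add: cf_state_def cf_quot_def frac_def field_simps)
  have s1: "cf_state rho 1 1 3 3 10"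
    by (rule cf_state_step[OF s0, where a = 3]) (use rho_bounds in simp_all)
  have s2: "cf_state rho 2 3 10 28 93"
    by (rule cf_state_step[OF s1, where a = 9]) (use rho_bounds in simp_all)
  have s3: "cf_state rho 3 28 93 59 196"
    by (rule cf_state_step[OF s2, where a = 2]) (use rho_bounds in simp_all)
  have s4: "cf_state rho 4 59 196 146 485"
    by (rule cf_state_step[OF s3, where a = 2]) (use rho_bounds in simp_all)
  have s5: "cf_state rho 5 146 485 643 2136"
    by (rule cf_state_step[OF s4, where a = 4]) (use rho_bounds in simp_all)
  have s6: "cf_state rho 6 643 2136 4004 13301"
    by (rule cf_state_step[OF s5, where a = 6]) (use rho_bounds in simp_all)
  have s7: "cf_state rho 7 4004 13301 8651 28738"
    by (rule cf_state_step[OF s6, where a = 2]) (use rho_bounds in simp_all)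
  have s8: "cf_state rho 8 8651 28738 12655 42039"
    by (rule cf_state_step[OF s7, where a = 1]) (use rho_bounds in simp_all)
  have s9: "cf_state rho 9 12655 42039 21306 70777"
    by (rule cf_state_step[OF s8, where a = 1]) (use rho_bounds in simp_all)
  have s10: "cf_state rho 10 21306 70777 76573 254370"
    by (rule cf_state_step[OF s9, where a = 3]) (use rho_bounds in simp_all)
  have s11: "cf_state rho 11 76573 254370 97879 325147"
    by (rule cf_state_step[OF s10, where a = 1]) (use rho_bounds in simp_all)
  have s12: "cf_state rho 12 97879 325147 1838395 6107016"
    by (rule cf_state_step[OF s11, where a = 18]) (use rho_bounds in simp_all)
  have s13: "cf_state rho 13 1838395 6107016 1936274 6432163"
    by (rule cf_state_step[OF s12, where a = 1]) (use rho_bounds in simp_all)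
  have s14: "cf_state rho 14 1936274 6432163 13456039 44699994"
    by (rule cf_state_step[OF s13, where a = 6]) (use rho_bounds in simp_all)
  show ?thesis
    using s14 unfolding adjacent_convergents_def cf_state_def by blast
qed

section \<open>The distance \<open>d\<close> and best approximation\<close>

lemma dist_int_eq_of_close:
  assumes "\<bar>x - of_int n\<bar> < 1 / 2"
  shows "dist_int x = \<bar>x - of_int n\<bar>"
proof -
  have "round x = n" using assms by (intro round_unique') (simp add: abs_minus_commute)
  then show ?thesis by (simp add: dist_int_def)
qed

lemma d_eq: "dist_int (6432163 * rho) = 6432163 * rho - 1936274"
proof -
  have "dist_int (6432163 * rho) = \<bar>6432163 * rho - of_int 1936274\<bar>"
    by (rule dist_int_eq_of_close) (use rho_bounds in \<open>simp add: abs_if\<close>)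
  then show ?thesis using rho_bounds by simp
qed

lemma d_bounds:
  "20276549588410307779 / 10 ^ 27 \<le> dist_int (6432163 * rho)"
  "dist_int (6432163 * rho) < 20276549588410307780 / 10 ^ 27"
  using rho_bounds by (simp_all add: d_eq)

text \<open>
  By unimodularity \<open>(k, n)\<close> is an integral combination \<open>a (q, p) + b (q', p')\<close>. The condition
  \<open>0 < k < q'\<close> forces \<open>a \<noteq> 0\<close> and \<open>a b \<le> 0\<close>. As the two errors have opposite signs as well, the
  contributions \<open>a e\<close> and \<open>b e'\<close> to \<open>k x - n\<close> reinforce each other, and \<open>\<bar>k x - n\<bar> \<ge> \<bar>a e\<bar> \<ge> \<bar>e\<bar>\<close>.
\<close>

lemma convergent_best_approximation:
  fixes x :: real and p q p' q' k n :: int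
  assumes det: "\<bar>q * p' - p * q'\<bar> = 1"
    and opposite: "(of_int q * x - of_int p) * (of_int q' * x - of_int p') \<le> 0"
    and "0 \<le> q" "0 < k" "k < q'"
  shows "\<bar>of_int q * x - of_int p\<bar> \<le> \<bar>of_int k * x - of_int n\<bar>"
proof -
  define s where "s = q * p' - p * q'"
  define a where "a = s * (k * p' - n * q')"
  define b where "b = s * (n * q - k * p)"
  define e where "e = of_int q * x - of_int p"
  define e' where "e' = of_int q' * x - of_int p'"
  have "s = 1 \<or> s = - 1" using det unfolding s_def by linarith
  then have s: "s * s = 1" by auto
  have "a * q + b * q' = (s * s) * k" by (simp add: a_def b_def s_def algebra_simps)
  then have k: "k = a * q + b * q'" using s by simp
  have "a * p + b * p' = (s * s) * n" by (simp add: a_def b_def s_def algebra_simps)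
  then have n: "n = a * p + b * p'" using s by simp
  have err: "of_int k * x - of_int n = of_int a * e + of_int b * e'"
    by (simp add: k n e_def e'_def algebra_simps)
  have ab: "a \<noteq> 0 \<and> a * b \<le> 0"
  proof (cases "0 < b")
    case True
    then have "q' \<le> b * q'" using \<open>k < q'\<close> \<open>0 < k\<close> by simp
    then have "a * q < 0" using k \<open>k < q'\<close> by linarith
    then have "a < 0" using \<open>0 \<le> q\<close> by (simp add: mult_less_0_iff)
    with True show ?thesis by (simp add: mult_le_0_iff)
  next
    case False
    then have "b * q' \<le> 0" using \<open>0 < k\<close> \<open>k < q'\<close> by (simp add: mult_le_0_iff)
    then have "0 < a * q" using k \<open>0 < k\<close> by linarith
    then have "0 < a" using \<open>0 \<le> q\<close> by (simp add: zero_less_mult_iff)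
    with False show ?thesis by (simp add: mult_le_0_iff)
  qed
  have "0 \<le> (of_int (a * b) :: real) * (e * e')"
    using ab opposite by (intro mult_nonpos_nonpos) (auto simp: e_def e'_def simp flip: of_int_mult)
  then have same: "0 \<le> (of_int a * e) * (of_int b * e')" by (simp add: mult_ac)
  have "\<bar>e\<bar> \<le> \<bar>of_int a\<bar> * \<bar>e\<bar>"
    using ab by (intro mult_le_cancel_right1[THEN iffD2]) auto
  also have "\<dots> = \<bar>of_int a * e\<bar>" by (simp add: abs_mult)
  also have "\<dots> \<le> \<bar>of_int a * e + of_int b * e'\<bar>"
    using same by (auto simp: zero_le_mult_iff)
  finally show ?thesis by (simp add: err flip: e_def)
qed

lemma rho_multiples_far_from_integers:
  assumes "0 < k" "k < 44699994"
  shows "dist_int (6432163 * rho) \<le> \<bar>of_int k * rho - of_int n\<bar>"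
proof -
  have "(6432163 * rho - 1936274) * (44699994 * rho - 13456039) \<le> 0"
    using rho_bounds by (intro mult_nonneg_nonpos) simp_all
  then have "\<bar>of_int 6432163 * rho - of_int 1936274\<bar> \<le> \<bar>of_int k * rho - of_int n\<bar>"
    by (intro convergent_best_approximation[of _ 13456039 _ 44699994]) (use assms in simp_all)
  then show ?thesis using rho_bounds by (simp add: d_eq)
qed

section \<open>The safe threshold\<close>

text \<open>
  The exact threshold \<open>q\<^sub>+ / (10\<^bsup>d/2\<^esup> - 1) - 1\<close> is about \<open>1914818931502441.206\<close>; it is enclosed between
  the neighbouring integers. The gaps are \<open>1.1 \<cdot> 10\<^sup>-\<^sup>1\<^sup>6\<close> and \<open>4.1 \<cdot> 10\<^sup>-\<^sup>1\<^sup>6\<close> in relative terms, and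
  the first term of the series of \<open>ln (1 + y)\<close> has a relative error of about \<open>y\<^sup>2 / 12\<close>, that is
  \<open>4.5 \<cdot> 10\<^sup>-\<^sup>1\<^sup>7\<close>.
\<close>

lemma powr_half_d_bounds:
  fixes d :: real
  assumes "d = dist_int (6432163 * rho)"
  shows "44699994 / 1914818931502443 \<le> 10 powr (d / 2) - 1"
    and "10 powr (d / 2) - 1 < 44699994 / 1914818931502442"
proof -
  have powr: "10 powr (d / 2) = exp (d / 2 * ln 10)" by (simp add: powr_def)
  have d: "20276549588410307779 / 10 ^ 27 \<le> d" "d \<le> 20276549588410307780 / 10 ^ 27"
    using d_bounds by (simp_all add: assms)
  have l10: "230258509299404568401 / 10 ^ 20 \<le> ln (10::real)"
    "ln (10::real) \<le> 230258509299404568402 / 10 ^ 20"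
    using ln_10_bounds by simp_all
  have lower: "20276549588410307779 / 10 ^ 27 / 2 * (230258509299404568401 / 10 ^ 20)
      \<le> d / 2 * ln 10"
    using d l10 by (intro mult_mono) simp_all
  have upper: "d / 2 * ln 10
      \<le> 20276549588410307780 / 10 ^ 27 / 2 * (230258509299404568402 / 10 ^ 20)"
    using d l10 by (intro mult_mono) simp_all
  have "ln (1 + 44699994 / 1914818931502443)
      \<le> (20276549588410307779 / 10 ^ 27 / 2 * (230258509299404568401 / 10 ^ 20) :: real)"
    using ln_approx_bounds[of "1 + 44699994 / 1914818931502443" 1]
    by (auto simp: power_divide elim!: order_trans)
  also note lower
  finally have "1 + 44699994 / 1914818931502443 \<le> exp (d / 2 * ln 10)"
    by (subst ln_le_cancel_iff[symmetric]) (simp_all del: ln_le_cancel_iff)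
  then show "44699994 / 1914818931502443 \<le> 10 powr (d / 2) - 1"
    by (simp add: powr)
  note upper
  also have "(20276549588410307780 / 10 ^ 27 / 2 * (230258509299404568402 / 10 ^ 20) :: real)
      < ln (1 + 44699994 / 1914818931502442)"
    using ln_approx_bounds[of "1 + 44699994 / 1914818931502442" 1]
    by (auto simp: power_divide elim!: less_le_trans[rotated])
  finally have "exp (d / 2 * ln 10) < 1 + 44699994 / 1914818931502442"
    by (subst ln_less_cancel_iff[symmetric]) (simp_all del: ln_less_cancel_iff)
  then show "10 powr (d / 2) - 1 < 44699994 / 1914818931502442"
    by (simp add: powr)
qed

lemma safe_threshold_iff:
  fixes d :: real
  assumes "d = dist_int (6432163 * rho)"
  shows "safe_threshold 44699994 d M \<longleftrightarrow> 1914818931502442 \<le> M"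
proof -
  define c where "c = 10 powr (d / 2) - 1"
  have c: "44699994 / 1914818931502443 \<le> c" "c < 44699994 / 1914818931502442"
    using powr_half_d_bounds[OF assms] by (simp_all add: c_def)
  have "c > 0" using c(1) by (rule less_le_trans[rotated]) simp
  have "1914818931502441 < 44699994 / c - 1" "44699994 / c - 1 \<le> 1914818931502442"
    using c \<open>c > 0\<close> by (simp_all add: field_simps)
  then show ?thesis
    unfolding safe_threshold_def c_def[symmetric] by simp linarith
qed

text \<open>
  The threshold is tailored to this bound: \<open>t\<^sub>H = log\<^sub>1\<^sub>0 (1 + H / (M + 1))\<close> is largest for \<open>H = q\<^sub>+\<close>
  and the least safe \<open>M\<close>.
\<close>

lemma loc_t_le_half:
  assumes "d = dist_int (6432163 * rho)"
    and "1914818931502442 \<le> M" "1 \<le> H" "H \<le> 44699994"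
  shows "loc_t M H \<le> d / 2"
proof -
  have M: "1914818931502443 \<le> real_of_int M + 1" using assms by simp
  have "(real_of_int M + real_of_int H + 1) / (real_of_int M + 1)
      = 1 + real_of_int H / (real_of_int M + 1)"
    using M by (simp add: field_simps)
  also have "\<dots> \<le> 1 + 44699994 / 1914818931502443"
    using M assms by (intro add_left_mono frac_le) simp_all
  also have "\<dots> \<le> 10 powr (d / 2)"
    using powr_half_d_bounds(1)[OF assms(1)] by simp
  finally have le: "(real_of_int M + real_of_int H + 1) / (real_of_int M + 1) \<le> 10 powr (d / 2)" .
  have "loc_t M H \<le> log 10 (10 powr (d / 2))"
    unfolding loc_t_def using le M assms by (subst log_le_cancel_iff) simp_all
  then show ?thesis by simp
qed

section \<open>Correctness of the locator\<close>

text \<open>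
  All quantities compared by the locator lie on the \<open>1/Q\<close> grid, so wrapping around the circle
  becomes the choice of an integer multiple of \<open>Q\<close>.
\<close>

lemma grid_mem_circle_arc_iff:
  assumes "0 < Q"
  shows "real_of_int (z mod Q) / of_int Q \<in> circle_arc Q u v
         \<longleftrightarrow> (\<exists>n. u \<le> z - n * Q \<and> z - n * Q \<le> v)"
proof -
  have Q: "real_of_int Q > 0" using assms by simp
  have r: "0 \<le> real_of_int (z mod Q) / of_int Q" "real_of_int (z mod Q) / of_int Q < 1"
    using assms by simp_all
  have z: "real_of_int z = of_int (z div Q) * of_int Q + of_int (z mod Q)"
    by (metis div_mult_mod_eq of_int_add of_int_mult)
  show ?thesis
  proof
    assume "real_of_int (z mod Q) / of_int Q \<in> circle_arc Q u v"
    then obtain y where y: "of_int u / of_int Q \<le> y" "y \<le> of_int v / of_int Q"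
      and "real_of_int (z mod Q) / of_int Q = frac y"
      by (auto simp: circle_arc_def)
    then have "real_of_int (z mod Q) = (y - of_int \<lfloor>y\<rfloor>) * of_int Q"
      using Q by (simp add: frac_def field_simps)
    then have "real_of_int (z - (z div Q - \<lfloor>y\<rfloor>) * Q) = y * of_int Q"
      using z by (simp add: algebra_simps)
    then have "real_of_int u \<le> real_of_int (z - (z div Q - \<lfloor>y\<rfloor>) * Q)"
      "real_of_int (z - (z div Q - \<lfloor>y\<rfloor>) * Q) \<le> real_of_int v"
      using y Q by (simp_all add: field_simps)
    then show "\<exists>n. u \<le> z - n * Q \<and> z - n * Q \<le> v"
      unfolding of_int_le_iff by blast
  next
    assume "\<exists>n. u \<le> z - n * Q \<and> z - n * Q \<le> v"
    then obtain n where n: "u \<le> z - n * Q" "z - n * Q \<le> v" by blast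
    define y where "y = real_of_int (z - n * Q) / of_int Q"
    have "y = of_int (z div Q - n) + real_of_int (z mod Q) / of_int Q"
      using Q z by (simp add: y_def field_simps)
    then have "frac y = real_of_int (z mod Q) / of_int Q"
      using r by (simp add: frac_unique_iff)
    moreover have "y \<in> {of_int u / of_int Q .. of_int v / of_int Q}"
      using n Q by (simp add: y_def divide_right_mono del: of_int_diff of_int_mult)
    ultimately show "real_of_int (z mod Q) / of_int Q \<in> circle_arc Q u v"
      unfolding circle_arc_def by (metis imageI)
  qed
qed

lemma nearest_int_error:
  assumes "nearest_int B x"
  shows "\<bar>x - of_int B\<bar> \<le> 1 / 2"
proof -
  have "\<bar>x - of_int B\<bar> \<le> \<bar>x - of_int (round x)\<bar>"
    using assms by (simp add: nearest_int_def)
  also have "\<dots> \<le> 1 / 2" using of_int_round_abs_le[of x] by (simp add: abs_minus_commute)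
  finally show ?thesis .
qed

text \<open>
  Membership says that the leading digits of \<open>2\<^sup>m\<close> are those of \<open>m\<close>; logarithms make this a
  condition on the fractional part of \<open>m \<rho>\<close>.
\<close>

lemma S_2_10_log_bounds:
  assumes "m \<in> S_2_10"
  obtains k :: int where "log 10 (of_int m) \<le> of_int m * rho - of_int k"
    and "of_int m * rho - of_int k < log 10 (of_int m + 1)"
proof -
  from assms obtain k :: nat where m: "m \<ge> 1"
    and "m * 10 ^ k \<le> 2 ^ nat m" "2 ^ nat m < (m + 1) * 10 ^ k"
    by (auto simp: S_2_10_def)
  then have "real_of_int (m * 10 ^ k) \<le> real_of_int (2 ^ nat m)"
    "real_of_int (2 ^ nat m) < real_of_int ((m + 1) * 10 ^ k)"
    unfolding of_int_le_iff of_int_less_iff by simp_all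
  then have le: "real_of_int m * 10 ^ k \<le> 2 ^ nat m"
    and less: "2 ^ nat m < (real_of_int m + 1) * 10 ^ k"
    by simp_all
  have pow: "log 10 (2 ^ nat m) = of_int m * rho"
    using m by (simp add: log_nat_power rho_def)
  have prod: "log 10 (y * 10 ^ k) = log 10 y + real k" if "y > 0" for y
    using that by (simp add: log_mult log_nat_power)
  have "log 10 (real_of_int m * 10 ^ k) \<le> log 10 (2 ^ nat m)"
    using le m by (subst log_le_cancel_iff) simp_all
  moreover have "log 10 (2 ^ nat m) < log 10 ((real_of_int m + 1) * 10 ^ k)"
    using less m by (subst log_less_cancel_iff) simp_all
  ultimately show ?thesis
    using m that[of "int k"] by (simp add: pow prod)
qed

lemma scaled_orbit_point_error:
  fixes x y :: real and Q B P i :: int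
  assumes "nearest_int B (of_int Q * x)" "nearest_int P (of_int Q * y)" "0 \<le> i"
  shows "\<bar>of_int (B + P * i) - of_int Q * (x + of_int i * y)\<bar> \<le> (of_int i + 1) / 2"
proof -
  define a where "a = of_int Q * x - of_int B"
  define b where "b = of_int i * (of_int Q * y - of_int P)"
  have "\<bar>a\<bar> \<le> 1 / 2" using nearest_int_error[OF assms(1)] by (simp add: a_def)
  moreover have "\<bar>b\<bar> \<le> of_int i * (1 / 2)"
    using nearest_int_error[OF assms(2)] \<open>0 \<le> i\<close>
    unfolding b_def abs_mult by (intro mult_mono) simp_all
  ultimately have "\<bar>- a - b\<bar> \<le> (of_int i + 1) / 2"
    unfolding abs_le_iff by simp
  then show ?thesis by (simp add: a_def b_def algebra_simps)
qed

text \<open>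
  In units of \<open>1/Q\<close>, the arc extends \<open>[0, Q t]\<close> on either side by at least \<open>H + 1\<close>, which absorbs
  the rounding of the orbit, and by less than \<open>H + 4\<close>, which keeps it short.
\<close>

lemma arc_grid_bounds:
  assumes "0 < Q" "rounded_outward Q (- (of_int (H + 1) / of_int Q)) (t + of_int (H + 1) / of_int Q) u v"
  shows "of_int u \<le> - (of_int H + 1 :: real)" "- (of_int H + 4) < (of_int u :: real)"
    "of_int Q * t + of_int H + 1 \<le> of_int v" "of_int v < of_int Q * t + of_int H + 4"
proof -
  have Q: "real_of_int Q > 0" using assms by simp
  have scale: "of_int Q * (x / of_int Q) = x" for x :: real using Q by simp
  have "real_of_int Q * (of_int u / of_int Q) \<le> of_int Q * (- (of_int (H + 1) / of_int Q))"
    "real_of_int Q * (- (of_int (H + 1) / of_int Q) - of_int u / of_int Q) < of_int Q * (3 / of_int Q)"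
    "of_int Q * (t + of_int (H + 1) / of_int Q) \<le> of_int Q * (of_int v / of_int Q)"
    "of_int Q * (of_int v / of_int Q - (t + of_int (H + 1) / of_int Q)) < of_int Q * (3 / of_int Q)"
    using assms(2) unfolding mult_le_cancel_left_pos[OF Q] mult_less_cancel_left_pos[OF Q]
    by (simp_all only: rounded_outward_def)
  then show "of_int u \<le> - (of_int H + 1 :: real)" "- (of_int H + 4) < (of_int u :: real)"
    "of_int Q * t + of_int H + 1 \<le> of_int v" "of_int v < of_int Q * t + of_int H + 4"
    unfolding right_diff_distrib distrib_left mult_minus_right scale by simp_all
qed

text \<open>
  The orbit point of a member \<open>m = M + i\<close> is \<open>m \<rho> - log\<^sub>1\<^sub>0 (M + 1)\<close> mod 1. Since \<open>m\<close> and \<open>m + 1\<close> lie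
  between \<open>M + 1\<close> and \<open>M + H + 1\<close>, the logarithmic window of \<open>m\<close> is contained in \<open>[0, t\<^sub>H]\<close> after
  subtracting \<open>log\<^sub>1\<^sub>0 (M + 1)\<close>.
\<close>

lemma locator_complete:
  assumes "1 \<le> M" "safe_locator_data qm qp M H Q B P u v" "0 < Q"
  shows "S_2_10 \<inter> {M<..M + H} \<subseteq> reported M H Q B P u v"
proof
  fix m assume "m \<in> S_2_10 \<inter> {M<..M + H}"
  then have S: "m \<in> S_2_10" and "M < m" "m \<le> M + H" by simp_all
  define i where "i = m - M"
  have i: "1 \<le> i" "i \<le> H" "m = M + i" using \<open>M < m\<close> \<open>m \<le> M + H\<close> by (simp_all add: i_def)
  have nearB: "nearest_int B (of_int Q * loc_theta M)"
    and nearP: "nearest_int P (of_int Q * rho)"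
    and arc: "rounded_outward Q (- (of_int (H + 1) / of_int Q))
      (loc_t M H + of_int (H + 1) / of_int Q) u v"
    using assms(2) by (simp_all add: safe_locator_data_def)
  from S obtain k where k: "log 10 (of_int m) \<le> of_int m * rho - of_int k"
    "of_int m * rho - of_int k < log 10 (of_int m + 1)"
    by (rule S_2_10_log_bounds)
  \<comment> \<open>\<open>loc_theta\<close> has dropped an integer part, which is moved into the number of turns \<open>n\<close>.\<close>
  define n where "n = k - \<lfloor>of_int M * rho - log 10 (of_int M + 1)\<rfloor>"
  have theta: "loc_theta M + of_int i * rho - of_int n
      = of_int m * rho - of_int k - log 10 (of_int M + 1)"
    by (simp add: loc_theta_def frac_def n_def i(3) algebra_simps)
  have "log 10 (of_int M + 1) \<le> log 10 (of_int m)"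
    using \<open>1 \<le> M\<close> i by (subst log_le_cancel_iff) simp_all
  then have pos: "0 \<le> loc_theta M + of_int i * rho - of_int n"
    using k theta by linarith
  have t: "loc_t M H = log 10 (of_int M + of_int H + 1) - log 10 (of_int M + 1)"
    unfolding loc_t_def using \<open>1 \<le> M\<close> i by (subst log_divide) simp_all
  have "log 10 (of_int m + 1) \<le> log 10 (of_int M + of_int H + 1)"
    using \<open>1 \<le> M\<close> i by (subst log_le_cancel_iff) simp_all
  then have "loc_theta M + of_int i * rho - of_int n \<le> loc_t M H"
    using k theta t by linarith
  then have hi: "of_int Q * (loc_theta M + of_int i * rho - of_int n) \<le> of_int Q * loc_t M H"
    using \<open>0 < Q\<close> by simp
  have lo: "0 \<le> of_int Q * (loc_theta M + of_int i * rho - of_int n)"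
    using \<open>0 < Q\<close> pos by simp
  have err: "\<bar>of_int (B + P * i) - of_int Q * (loc_theta M + of_int i * rho)\<bar> \<le> (of_int i + 1) / 2"
    by (rule scaled_orbit_point_error[OF nearB nearP]) (use i in simp)
  have z: "of_int (B + P * i - n * Q) = (of_int (B + P * i) - of_int Q * (loc_theta M + of_int i * rho))
      + of_int Q * (loc_theta M + of_int i * rho - of_int n)"
    by (simp add: algebra_simps)
  have iH: "(of_int i + 1) / 2 \<le> (of_int H + 1 :: real)"
    using i by simp
  have "real_of_int u \<le> of_int (B + P * i - n * Q)" "of_int (B + P * i - n * Q) \<le> real_of_int v"
    using arc_grid_bounds[OF \<open>0 < Q\<close> arc] err lo hi iH unfolding z by linarith+
  then have "real_of_int ((B + P * i) mod Q) / of_int Q \<in> circle_arc Q u v"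
    unfolding of_int_le_iff grid_mem_circle_arc_iff[OF \<open>0 < Q\<close>] by blast
  then show "m \<in> reported M H Q B P u v"
    unfolding reported_def using i by blast
qed

text \<open>
  The arc has length less than \<open>t\<^sub>H + (2 H + 8) / Q\<close>, and replacing \<open>(j - i) P\<close> by
  \<open>(j - i) Q \<rho>\<close> costs at most \<open>H / 2\<close> grid steps. Two reported candidates thus give
  \<open>Q d < Q d / 2 + 5 H / 2 + 8\<close>, whereas the size of \<open>Q\<close> and \<open>d (q\<^sub>+ + q\<^sub>-) \<ge> 1\<close> give \<open>Q d > 16 (H + 3)\<close>.
\<close>

lemma locator_separates:
  fixes d :: real
  assumes data: "safe_locator_data qm qp M H Q B P u v"
    and "1 \<le> H" "0 < qm + qp"
    and far: "\<And>k n. 0 < k \<Longrightarrow> k < H \<Longrightarrow> d \<le> \<bar>of_int k * rho - of_int n\<bar>"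
    and narrow: "loc_t M H \<le> d / 2"
    and gap: "1 \<le> d * of_int (qp + qm)"
    and "1 \<le> i" "i < j" "j \<le> H"
    and "M + i \<in> reported M H Q B P u v" "M + j \<in> reported M H Q B P u v"
  shows False
proof -
  have Q_large: "16 * (H + 3) * (qp + qm) < Q"
    and nearP: "nearest_int P (of_int Q * rho)"
    and arc: "rounded_outward Q (- (of_int (H + 1) / of_int Q))
      (loc_t M H + of_int (H + 1) / of_int Q) u v"
    using data by (simp_all add: safe_locator_data_def)
  have "0 < 16 * (H + 3) * (qp + qm)" using \<open>1 \<le> H\<close> \<open>0 < qm + qp\<close> by simp
  then have Q: "0 < Q" using Q_large by linarith
  obtain n1 n2 where
    "u \<le> B + P * i - n1 * Q" "B + P * i - n1 * Q \<le> v"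
    "u \<le> B + P * j - n2 * Q" "B + P * j - n2 * Q \<le> v"
    using assms(10,11) by (auto simp: reported_def grid_mem_circle_arc_iff[OF Q])
  then have "\<bar>P * (j - i) - (n2 - n1) * Q\<bar> \<le> v - u"
    by (simp add: algebra_simps abs_le_iff)
  define k where "k = j - i"
  define n where "n = n2 - n1"
  have k: "0 < k" "k < H" using assms(7-9) by (simp_all add: k_def)
  have "\<bar>P * k - n * Q\<bar> \<le> v - u" using \<open>\<bar>P * (j - i) - (n2 - n1) * Q\<bar> \<le> v - u\<close>
    by (simp add: k_def n_def)
  then have "real_of_int \<bar>P * k - n * Q\<bar> \<le> of_int (v - u)" unfolding of_int_le_iff .
  moreover have "real_of_int (v - u) < of_int Q * loc_t M H + 2 * of_int H + 8"
    using arc_grid_bounds[OF Q arc] by simp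
  ultimately have grid: "\<bar>of_int P * of_int k - of_int n * of_int Q\<bar>
      < of_int Q * loc_t M H + 2 * of_int H + (8::real)"
    by simp
  have "\<bar>of_int k * (of_int Q * rho - of_int P)\<bar> \<le> of_int k * (1 / 2)"
    using nearest_int_error[OF nearP] k unfolding abs_mult by (intro mult_mono) simp_all
  moreover have "of_int Q * (of_int k * rho - of_int n)
      = (of_int P * of_int k - of_int n * of_int Q) + of_int k * (of_int Q * rho - of_int P)"
    by (simp add: algebra_simps)
  ultimately have "\<bar>of_int Q * (of_int k * rho - of_int n)\<bar>
      < of_int Q * loc_t M H + 5 / 2 * of_int H + 8"
    using grid k by linarith
  moreover have "of_int Q * d \<le> \<bar>of_int Q * (of_int k * rho - of_int n)\<bar>"
    using far[OF k] Q by (simp add: abs_mult)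
  moreover have "of_int Q * loc_t M H \<le> of_int Q * (d / 2)"
    using narrow Q by (intro mult_left_mono) simp_all
  ultimately have small: "of_int Q * d < 5 * of_int H + 16" by linarith
  have d: "0 < d" using gap \<open>0 < qm + qp\<close> 
    by (smt (verit) mult_nonpos_nonneg of_int_nonneg)
  have "16 * (of_int H + 3) * 1 \<le> 16 * (of_int H + 3) * (d * of_int (qp + qm))"
    using gap \<open>1 \<le> H\<close> by (intro mult_left_mono) simp_all
  also have "\<dots> = of_int (16 * (H + 3) * (qp + qm)) * d" by (simp add: algebra_simps)
  also have "\<dots> < of_int Q * d" 
    using Q_large d by (intro mult_strict_right_mono) (simp_all only: of_int_less_iff)
  finally show False using small \<open>1 \<le> H\<close> by simp
qed

text \<open>
  Differences of candidates stay below \<open>H \<le> q\<^sub>+\<close>, so the best approximation bound applies to all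
  of them.
\<close>

lemma safe_locator_reduces:
  assumes "d = dist_int (6432163 * rho)"
    and "1914818931502442 \<le> M" "1 \<le> H" "H \<le> 44699994"
    and data: "safe_locator_data 6432163 44699994 M H Q B P u v"
  shows "reduced_to_at_most_one M H (reported M H Q B P u v)"
proof -
  let ?R = "reported M H Q B P u v"
  have "0 < 16 * (H + 3) * (44699994 + 6432163)" using \<open>1 \<le> H\<close> by simp
  then have "0 < Q" using data unfolding safe_locator_data_def by linarith
  then have complete: "S_2_10 \<inter> {M<..M + H} \<subseteq> ?R"
    using assms by (intro locator_complete[OF _ data]) simp_all
  have R: "\<exists>i. m = M + i \<and> 1 \<le> i \<and> i \<le> H" if "m \<in> ?R" for m
    using that by (auto simp: reported_def)
  have separated: False if "1 \<le> i" "i < j" "j \<le> H" "M + i \<in> ?R" "M + j \<in> ?R" for i j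
  proof (rule locator_separates[OF data \<open>1 \<le> H\<close> _ _ loc_t_le_half[OF assms(1-4)] _ that])
    show "d \<le> \<bar>of_int k * rho - of_int n\<bar>" if "0 < k" "k < H" for k n
      unfolding assms(1) by (rule rho_multiples_far_from_integers) (use that assms(4) in simp_all)
    show "1 \<le> d * of_int (44699994 + 6432163)"
      using d_bounds(1) unfolding assms(1) by simp
  qed simp
  have unique: "m = m'" if "m \<in> ?R" "m' \<in> ?R" for m m'
    using R[OF that(1)] R[OF that(2)] that separated by (metis linorder_less_linear)
  have "?R \<subseteq> {M..M + H}" using R by force
  then have "finite ?R" by (rule finite_subset) simp
  moreover from this have "card ?R \<le> 1"
    using unique by (metis One_nat_def card_le_Suc0_iff_eq)
  ultimately show ?thesis using complete by (simp add: reduced_to_at_most_one_def)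
qed

theorem corollary6p8:
  fixes d :: real
  assumes d_def: "d = dist_int (6432163 * rho)"
  shows "adjacent_convergents rho 1936274 6432163 13456039 44699994
    \<and> 20276549588410307779 / 10 ^ 27 \<le> d \<and> d < 20276549588410307780 / 10 ^ 27
    \<and> safe_threshold 44699994 d 1914818931502442
    \<and> (\<forall>M. safe_threshold 44699994 d M \<longrightarrow> 1914818931502442 \<le> M)
    \<and> (\<forall>M H Q B P u v.
         M \<ge> 1914818931502442 \<longrightarrow> 1 \<le> H \<longrightarrow> H \<le> 44699994 \<longrightarrow>
         safe_locator_data 6432163 44699994 M H Q B P u v \<longrightarrow>
         reduced_to_at_most_one M H (reported M H Q B P u v))"
  using rho_adjacent_convergents d_bounds safe_threshold_iff[OF d_def]
    safe_locator_reduces[OF d_def]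
  by (auto simp flip: d_def)

end
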